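(* Let $\Lambda$ be a lattice, let $\mathbf{k}$ be a field, and let $f\in \mathrm{Fun}(\Lambda,\mathbf{k})$ be any function. Then $\mathrm{Ann}(f)=\{s\in \mathrm{Sh}(\Lambda)\mid s\cdot f\equiv 0\}$ is an ideal in $\mathrm{Sh}(\Lambda)$, so that the quotient algebra $K_f=\mathrm{Sh}(\Lambda)/\mathrm{Ann}(f)$ is well defined. Moreover, the linear function $\ell_f\colon \mathrm{Sh}(\Lambda)\to\mathbf{k}$, $\ell_f(t)=(t\cdot f)(0)$, descends to a well-defined linear function on $K_f$, and it defines a Frobenius duality on $K_f$, i.e. the symmetric bilinear pairing $\langle a,b\rangle=\ell_f(ab)$ on $K_f$ is non-degenerate.
   Context: A lattice is a free abelian group, possibly of infinite rank. $\mathrm{Fun}(\Lambda,\mathbf{k})$ is the set of all maps $\Lambda\to\mathbf{k}$. $\mathrm{Sh}(\Lambda)=\mathbf{k}[\Lambda]$ is the group algebra of $\Lambda$, called the algebra of shift operators with constant coefficients; it acts on $\mathrm{Fun}(\Lambda,\mathbf{k})$ by $(t\cdot f)(x)=\sum_i a_i f(x+\lambda_i)$ for $t=\sum_i a_i\lambda_i$ with $a_i\in\mathbf{k}$, $\lambda_i\in\Lambda$. The algebra $K_f$ is called the discrete Pukhlikov--Khovanskii algebra of $f$. For a commutative $\mathbf{k}$-algebra $A$, a linear function $\ell\colon A\to\mathbf{k}$ defines the symmetric bilinear pairing $\langle a,b\rangle_\ell=\ell(ab)$, which is called a Frobenius duality if it is non-degenerate (for every $0\neq a\in A$ there is $b\in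 A$ with $\ell(ab)\neq 0$). *)

theory Defs
  imports "HOL-Algebra.Algebra" "HOL-Algebra.Algebraic_Closure_Type"
begin

definition additive_group :: "'l::ab_group_add monoid"
  where "additive_group = \<lparr>carrier = UNIV, monoid.mult = (+), one = 0\<rparr>"

text \<open>The basis \<open>S\<close> may be any set, possibly infinite or empty. Taking it inside the type of the
  elements of \<open>G\<close> is no restriction, since a basis can always be chosen as a subset of \<open>G\<close>.\<close>

definition free_abelian :: "('a, 'b) monoid_scheme \<Rightarrow> bool"
  where "free_abelian G \<longleftrightarrow> (\<exists>S :: 'a set. G \<cong> free_Abelian_group S)"

text \<open>The group algebra \<open>k[\<Lambda>]\<close>: finitely supported maps \<open>\<Lambda> \<Rightarrow>\<^sub>0 k\<close> with the convolution
  product of the library; \<open>\<lambda> \<in> \<Lambda>\<close> corresponds to \<open>Poly_Mapping.single \<lambda> 1\<close>.\<close>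

definition Sh :: "('k::field, 'l::ab_group_add \<Rightarrow>\<^sub>0 'k) module"
  where "Sh = \<lparr>carrier = UNIV, monoid.mult = (*), one = 1, ring.zero = 0, add = (+),
                module.smult = (\<lambda>c. Poly_Mapping.map ((*) c))\<rparr>"

definition act :: "('l::ab_group_add \<Rightarrow>\<^sub>0 'k::field) \<Rightarrow> ('l \<Rightarrow> 'k) \<Rightarrow> 'l \<Rightarrow> 'k"
  where "act t f x = (\<Sum>v\<in>Poly_Mapping.keys t. Poly_Mapping.lookup t v * f (x + v))"

definition Ann :: "('l::ab_group_add \<Rightarrow> 'k::field) \<Rightarrow> ('l \<Rightarrow>\<^sub>0 'k) set"
  where "Ann f = {s \<in> carrier Sh. \<forall>x. act s f x = 0}"

text \<open>The ring \<open>A Quot I\<close> together with the induced scalar multiplication on cosets. The latter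
  is written as a union over representatives, like \<open>rcoset_mult\<close> in the library, so that it makes
  sense before independence of the representative is known.\<close>

definition quotient_algebra :: "('k, 'a) module \<Rightarrow> 'a set \<Rightarrow> ('k, 'a set) module"
  where "quotient_algebra A I =
    \<lparr>carrier = carrier (A Quot I), monoid.mult = monoid.mult (A Quot I), one = one (A Quot I),
     ring.zero = ring.zero (A Quot I), add = add (A Quot I),
     module.smult = (\<lambda>c Y. \<Union>x\<in>Y. I +>\<^bsub>A\<^esub> (c \<odot>\<^bsub>A\<^esub> x))\<rparr>"

definition PK_algebra :: "('l::ab_group_add \<Rightarrow> 'k::field) \<Rightarrow> ('k, ('l \<Rightarrow>\<^sub>0 'k) set) module"
  where "PK_algebra f = quotient_algebra Sh (Ann f)"

definition ell :: "('l::ab_group_add \<Rightarrow> 'k::field) \<Rightarrow> ('l \<Rightarrow>\<^sub>0 'k) \<Rightarrow> 'k"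
  where "ell f t = act t f 0"

text \<open>The common value of \<open>ell f\<close> on the elements of a coset; it is only meaningful once
  \<open>ell f\<close> is known to be constant on cosets of \<open>Ann f\<close>.\<close>

definition ell_quot :: "('l::ab_group_add \<Rightarrow> 'k::field) \<Rightarrow> ('l \<Rightarrow>\<^sub>0 'k) set \<Rightarrow> 'k"
  where "ell_quot f Y = the_elem (ell f ` Y)"

definition linear_function :: "('k::field, 'a) module \<Rightarrow> ('a \<Rightarrow> 'k) \<Rightarrow> bool"
  where "linear_function A l \<longleftrightarrow>
    (\<forall>a\<in>carrier A. \<forall>b\<in>carrier A. l (a \<oplus>\<^bsub>A\<^esub> b) = l a + l b) \<and>
    (\<forall>c. \<forall>a\<in>carrier A. l (c \<odot>\<^bsub>A\<^esub> a) = c * l a)"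

definition pairing :: "('k::field, 'a) module \<Rightarrow> ('a \<Rightarrow> 'k) \<Rightarrow> 'a \<Rightarrow> 'a \<Rightarrow> 'k"
  where "pairing A l a b = l (a \<otimes>\<^bsub>A\<^esub> b)"

definition symmetric_bilinear :: "('k::field, 'a) module \<Rightarrow> ('a \<Rightarrow> 'a \<Rightarrow> 'k) \<Rightarrow> bool"
  where "symmetric_bilinear A B \<longleftrightarrow>
    (\<forall>a\<in>carrier A. \<forall>b\<in>carrier A. B a b = B b a) \<and>
    (\<forall>a\<in>carrier A. linear_function A (\<lambda>b. B a b)) \<and>
    (\<forall>b\<in>carrier A. linear_function A (\<lambda>a. B a b))"

definition nondegenerate :: "('k::field, 'a) module \<Rightarrow> ('a \<Rightarrow> 'a \<Rightarrow> 'k) \<Rightarrow> bool"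
  where "nondegenerate A B \<longleftrightarrow>
    (\<forall>a\<in>carrier A. a \<noteq> \<zero>\<^bsub>A\<^esub> \<longrightarrow> (\<exists>b\<in>carrier A. B a b \<noteq> 0))"

definition frobenius_duality :: "('k::field, 'a) module \<Rightarrow> ('a \<Rightarrow> 'k) \<Rightarrow> bool"
  where "frobenius_duality A l \<longleftrightarrow>
    linear_function A l \<and> symmetric_bilinear A (pairing A l) \<and> nondegenerate A (pairing A l)"

text \<open>The group algebra is a commutative algebra, and \<open>act\<close> respects its sum, product and unit.\<close>

lemma cring_Sh: "cring (Sh :: ('k::field, 'l::ab_group_add \<Rightarrow>\<^sub>0 'k) module)"
  by (unfold_locales)
     (auto simp: Sh_def algebra_simps Units_def intro: exI[of _ "- x" for x] add.right_inverse)

lemma algebra_Sh: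
  "algebra (ring_of_type_algebra :: 'k::field ring) (Sh :: ('k, 'l::ab_group_add \<Rightarrow>\<^sub>0 'k) module)"
proof (rule algebraI)
  show "cring (ring_of_type_algebra :: 'k ring)"
    by (rule cring_from_type_algebra)
  show "cring (Sh :: ('k, 'l \<Rightarrow>\<^sub>0 'k) module)"
    by (rule cring_Sh)
qed (auto simp: Sh_def ring_of_type_algebra_def mult_map_scale_conv_mult single_add mult_single
      algebra_simps simp flip: mult.assoc)

lemma poly_mapping_single_induct [case_names zero single_add]:
  fixes p :: "'a \<Rightarrow>\<^sub>0 'b::comm_monoid_add"
  assumes "P 0" and "\<And>k c q. P q \<Longrightarrow> P (Poly_Mapping.single k c + q)"
  shows "P p"
proof (induction p rule: update_induct)
  case const
  then show ?case by (rule assms(1))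
next
  case (update p k c)
  have "Poly_Mapping.update k c p = Poly_Mapping.single k c + p"
    using update by (intro poly_mapping_eqI)
      (auto simp: lookup_update lookup_add lookup_single when_def in_keys_iff)
  then show ?case using assms(2)[OF update.IH] by simp
qed

lemma act_superset:
  assumes "finite V" "Poly_Mapping.keys t \<subseteq> V"
  shows "act t f x = (\<Sum>v\<in>V. Poly_Mapping.lookup t v * f (x + v))"
  unfolding act_def using assms by (intro sum.mono_neutral_left) (auto simp: in_keys_iff)

lemma act_single [simp]: "act (Poly_Mapping.single v a) f x = a * f (x + v)"
  by (subst act_superset[of "{v}"]) auto

lemma act_one [simp]: "act 1 f = f"
  by (rule ext) (simp add: act_single flip: single_one)

lemma act_zero [simp]: "act 0 f x = 0"
  by (simp add: act_def)

lemma act_add: "act (s + t) f x = act s f x + act t f x"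
proof -
  let ?V = "Poly_Mapping.keys s \<union> Poly_Mapping.keys t"
  have "Poly_Mapping.keys (s + t) \<subseteq> ?V"
    by (rule Poly_Mapping.keys_add)
  then show ?thesis
    by (simp add: act_superset[of ?V] lookup_add distrib_right sum.distrib)
qed

lemma act_mult: "act (s * t) f = act s (act t f)"
proof (rule ext)
  fix x
  have single: "act (Poly_Mapping.single v a * t) f x = a * act t f (x + v)" for v a x
    by (induction t rule: poly_mapping_single_induct)
       (simp_all add: mult_single distrib_left act_add add.assoc mult.assoc)
  show "act (s * t) f x = act s (act t f) x"
    by (induction s rule: poly_mapping_single_induct)
       (simp_all add: distrib_right act_add single)
qed

end

theory Submission
  imports Defs
begin

text \<open>
  Since \<open>act (s * t) f = act s (act t f)\<close>, the group algebra acts on functions, so the annihilator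
  of \<open>f\<close> is an ideal, and the quotient of an algebra by an ideal is again an algebra
  (\<open>algebra_quotient_algebra\<close>). Two elements lie in the same coset of \<open>Ann f\<close> exactly when they
  have the same action on \<open>f\<close> (\<open>coset_Ann\<close>); hence \<open>ell f\<close>, which only looks at the value of that
  action at \<open>0\<close>, is constant on cosets.

  Nondegeneracy holds because \<open>\<Lambda>\<close> acts transitively on itself by translations: if the class of \<open>s\<close>
  is nonzero, then \<open>act s f x \<noteq> 0\<close> for some \<open>x\<close>, and multiplying \<open>s\<close> by the shift by \<open>x\<close> moves this
  value to \<open>0\<close>, that is, \<open>ell f (s * single x 1) = act s f x \<noteq> 0\<close>.
\<close>

text \<open>Being a commutative ring depends only on the five ring fields of a record. The rings \<open>A\<close> and
  \<open>B\<close> may carry additional fields of different types, which is the situation of \<open>A Quot I\<close> (a bare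
  ring) and \<open>quotient_algebra A I\<close> (which also has a scalar multiplication).\<close>

lemma cring_cong_fields:
  fixes A :: "('a, 'b) ring_scheme" and B :: "('a, 'c) ring_scheme"
  assumes "cring A" "carrier B = carrier A" "monoid.mult B = monoid.mult A" "one B = one A"
    "ring.zero B = ring.zero A" "add B = add A"
  shows "cring B"
proof -
  \<comment> \<open>The additive monoids of \<open>A\<close> and \<open>B\<close> are records of different types, so they cannot be
    equated; the axioms are unfolded down to the fields instead.\<close>
  have "cring B = cring A"
    unfolding cring_def ring_def ring_axioms_def abelian_group_def abelian_monoid_def
      abelian_group_axioms_def comm_group_def comm_monoid_def comm_monoid_axioms_def group_def
      group_axioms_def Group.monoid_def Units_def
    by (simp add: assms(2-6))
  with assms(1) show ?thesis
    by simp
qed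

lemma quotient_algebra_simps:
  "carrier (quotient_algebra A I) = (\<lambda>x. I +>\<^bsub>A\<^esub> x) ` carrier A"
  "monoid.mult (quotient_algebra A I) = rcoset_mult A I"
  "one (quotient_algebra A I) = I +>\<^bsub>A\<^esub> one A"
  "ring.zero (quotient_algebra A I) = I"
  "add (quotient_algebra A I) = set_add A"
  by (auto simp: quotient_algebra_def FactRing_simps)

lemma ring_hom_quotient_algebra:
  assumes "ideal I A"
  shows "(\<lambda>x. I +>\<^bsub>A\<^esub> x) \<in> ring_hom A (quotient_algebra A I)"
proof -
  interpret ideal I A by fact
  show ?thesis
    by (rule ring_hom_memI) (simp_all add: quotient_algebra_simps rcoset_mult_add a_rcos_sum)
qed

context algebra
begin

text \<open>Ideals are closed under scalar multiplication because \<open>c \<odot> x = (c \<odot> \<one>) \<otimes> x\<close>.\<close>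

lemma ideal_smult_closed:
  assumes "ideal I M" "c \<in> carrier R" "x \<in> I"
  shows "c \<odot>\<^bsub>M\<^esub> x \<in> I"
proof -
  interpret ideal I M by fact
  have "(c \<odot>\<^bsub>M\<^esub> \<one>\<^bsub>M\<^esub>) \<otimes>\<^bsub>M\<^esub> x \<in> I"
    using assms by (intro I_l_closed) auto
  then show ?thesis
    using assms by (simp add: smult_assoc2)
qed

lemma smult_coset:
  assumes "ideal I M" "c \<in> carrier R" "x \<in> carrier M"
  shows "(\<Union>y\<in>I +>\<^bsub>M\<^esub> x. I +>\<^bsub>M\<^esub> (c \<odot>\<^bsub>M\<^esub> y)) = I +>\<^bsub>M\<^esub> (c \<odot>\<^bsub>M\<^esub> x)"
proof -
  interpret ideal I M by fact
  have "I +>\<^bsub>M\<^esub> (c \<odot>\<^bsub>M\<^esub> y) = I +>\<^bsub>M\<^esub> (c \<odot>\<^bsub>M\<^esub> x)" if y: "y \<in> I +>\<^bsub>M\<^esub> x" for y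
  proof -
    obtain i where i: "i \<in> I" "y = i \<oplus>\<^bsub>M\<^esub> x"
      using y by (auto simp: a_r_coset_def')
    then have "c \<odot>\<^bsub>M\<^esub> y = (c \<odot>\<^bsub>M\<^esub> i) \<oplus>\<^bsub>M\<^esub> (c \<odot>\<^bsub>M\<^esub> x)"
      using assms by (simp add: smult_r_distr)
    then have "c \<odot>\<^bsub>M\<^esub> y \<in> I +>\<^bsub>M\<^esub> (c \<odot>\<^bsub>M\<^esub> x)"
      using ideal_smult_closed[OF assms(1,2) i(1)] by (auto simp: a_r_coset_def')
    then show ?thesis
      using assms by (intro a_repr_independence'[symmetric]) auto
  qed
  then show ?thesis
    using a_rcos_self[OF assms(3)] by blast
qed

end

lemma smult_quotient_algebra:
  assumes "algebra R A" "ideal I A" "c \<in> carrier R" "x \<in> carrier A"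
  shows "c \<odot>\<^bsub>quotient_algebra A I\<^esub> (I +>\<^bsub>A\<^esub> x) = I +>\<^bsub>A\<^esub> (c \<odot>\<^bsub>A\<^esub> x)"
  using algebra.smult_coset[OF assms] by (simp add: quotient_algebra_def)

lemma algebra_quotient_algebra:
  assumes "algebra R A" "ideal I A"
  shows "algebra R (quotient_algebra A I)"
proof -
  interpret algebra R A by fact
  interpret ideal I A by fact
  note smult = smult_quotient_algebra[OF assms]
  show ?thesis
  proof (rule algebraI)
    show "cring (quotient_algebra A I)"
      by (rule cring_cong_fields[OF quotient_is_cring[OF M_cring]])
         (simp_all add: quotient_algebra_def)
  qed (auto simp: quotient_algebra_simps smult rcoset_mult_add a_rcos_sum R_cring smult_l_distr
      smult_r_distr smult_assoc1 smult_assoc2)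
qed

lemma carrier_type_ring [simp]: "carrier ring_of_type_algebra = UNIV"
  by (simp add: ring_of_type_algebra_def)

lemma Sh_simps [simp]:
  "carrier Sh = UNIV" "s \<otimes>\<^bsub>Sh\<^esub> t = s * t" "s \<oplus>\<^bsub>Sh\<^esub> t = s + t" "\<one>\<^bsub>Sh\<^esub> = 1" "\<zero>\<^bsub>Sh\<^esub> = 0"
  "c \<odot>\<^bsub>Sh\<^esub> t = Poly_Mapping.single 0 c * t"
  by (simp_all add: Sh_def mult_map_scale_conv_mult)

lemma act_minus: "act (s - t) f x = act s f x - act t f x"
  using act_add[of "s - t" t f x] by simp

lemma act_zero_fun: "act s (\<lambda>x. 0) x = 0"
  by (simp add: act_def)

lemma ideal_Ann: "ideal (Ann f) Sh"
proof -
  interpret cring Sh by (rule cring_Sh)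
  have left: "s * t \<in> Ann f" if "t \<in> Ann f" for s t
  proof -
    have "act t f = (\<lambda>x. 0)"
      using that by (auto simp: Ann_def)
    then show ?thesis
      by (simp add: Ann_def act_mult act_zero_fun)
  qed
  have right: "t * s \<in> Ann f" if "t \<in> Ann f" for s t
    using left[OF that, of s] by (simp add: mult.commute)
  show ?thesis
  proof (rule idealI)
    show "subgroup (Ann f) (add_monoid Sh)"
    proof (rule add.subgroupI)
      fix s assume "s \<in> Ann f"
      moreover have "\<ominus>\<^bsub>Sh\<^esub> s = - s"
        by (rule minus_equality) simp_all
      ultimately show "\<ominus>\<^bsub>Sh\<^esub> s \<in> Ann f"
        using left[of s "- 1"] by simp
    next
      show "Ann f \<noteq> {}"
        by (auto simp: Ann_def intro!: exI[of _ 0])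
    qed (auto simp: Ann_def act_add)
  qed (simp_all add: left right ring_axioms)
qed

lemma coset_Ann: "Ann f +>\<^bsub>Sh\<^esub> t = {s. act s f = act t f}"
proof (intro equalityI subsetI)
  fix s assume "s \<in> Ann f +>\<^bsub>Sh\<^esub> t"
  then show "s \<in> {s. act s f = act t f}"
    by (auto simp: a_r_coset_def' Ann_def act_add)
next
  fix s assume "s \<in> {s. act s f = act t f}"
  then have "s - t \<in> Ann f"
    by (simp add: Ann_def act_minus)
  then show "s \<in> Ann f +>\<^bsub>Sh\<^esub> t"
    by (auto simp: a_r_coset_def' intro!: bexI[of _ "s - t"])
qed

lemma ell_quot_coset [simp]: "ell_quot f (Ann f +>\<^bsub>Sh\<^esub> t) = ell f t"
proof -
  have "ell f ` (Ann f +>\<^bsub>Sh\<^esub> t) = {ell f t}"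
    by (auto simp: coset_Ann ell_def)
  then show ?thesis
    by (simp add: ell_quot_def)
qed

lemma linear_function_ell: "linear_function Sh (ell f)"
  by (simp add: linear_function_def ell_def act_add act_mult)

lemma carrier_PK_algebra: "carrier (PK_algebra f) = range (\<lambda>t. Ann f +>\<^bsub>Sh\<^esub> t)"
  by (simp add: PK_algebra_def quotient_algebra_simps)

lemma PK_algebra_coset_simps:
  "(Ann f +>\<^bsub>Sh\<^esub> s) \<oplus>\<^bsub>PK_algebra f\<^esub> (Ann f +>\<^bsub>Sh\<^esub> t) = Ann f +>\<^bsub>Sh\<^esub> (s + t)"
  "(Ann f +>\<^bsub>Sh\<^esub> s) \<otimes>\<^bsub>PK_algebra f\<^esub> (Ann f +>\<^bsub>Sh\<^esub> t) = Ann f +>\<^bsub>Sh\<^esub> (s * t)"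
  "c \<odot>\<^bsub>PK_algebra f\<^esub> (Ann f +>\<^bsub>Sh\<^esub> t) = Ann f +>\<^bsub>Sh\<^esub> (Poly_Mapping.single 0 c * t)"
proof -
  interpret ideal "Ann f" Sh by (rule ideal_Ann)
  show "(Ann f +>\<^bsub>Sh\<^esub> s) \<oplus>\<^bsub>PK_algebra f\<^esub> (Ann f +>\<^bsub>Sh\<^esub> t) = Ann f +>\<^bsub>Sh\<^esub> (s + t)"
    by (simp add: PK_algebra_def quotient_algebra_simps a_rcos_sum)
  show "(Ann f +>\<^bsub>Sh\<^esub> s) \<otimes>\<^bsub>PK_algebra f\<^esub> (Ann f +>\<^bsub>Sh\<^esub> t) = Ann f +>\<^bsub>Sh\<^esub> (s * t)"
    by (simp add: PK_algebra_def quotient_algebra_simps rcoset_mult_add)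
  show "c \<odot>\<^bsub>PK_algebra f\<^esub> (Ann f +>\<^bsub>Sh\<^esub> t) = Ann f +>\<^bsub>Sh\<^esub> (Poly_Mapping.single 0 c * t)"
    using smult_quotient_algebra[OF algebra_Sh ideal_Ann, of c t f] by (simp add: PK_algebra_def)
qed

lemma linear_function_ell_quot: "linear_function (PK_algebra f) (ell_quot f)"
  using linear_function_ell[of f]
  by (auto simp: linear_function_def carrier_PK_algebra PK_algebra_coset_simps)

text \<open>The condition on the carrier of \<open>R\<close> is needed because \<open>linear_function\<close> ranges over all
  scalars of the underlying type.\<close>

lemma symmetric_bilinear_pairing:
  assumes "algebra R A" "carrier R = UNIV" "linear_function A l"
  shows "symmetric_bilinear A (pairing A l)"
proof -
  interpret A: cring A by (rule algebra.M_cring[OF assms(1)])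
  interpret algebra R A by fact
  have smult_right: "a \<otimes>\<^bsub>A\<^esub> (c \<odot>\<^bsub>A\<^esub> b) = c \<odot>\<^bsub>A\<^esub> (a \<otimes>\<^bsub>A\<^esub> b)"
    if "a \<in> carrier A" "b \<in> carrier A" for a b c
    using that assms(2) by (simp add: A.m_comm[of a] smult_assoc2)
  show ?thesis
    using assms(2,3)
    by (auto simp: symmetric_bilinear_def linear_function_def pairing_def A.m_comm A.l_distr
        A.r_distr smult_assoc2 smult_right)
qed

lemma nondegenerate_ell_quot: "nondegenerate (PK_algebra f) (pairing (PK_algebra f) (ell_quot f))"
  unfolding nondegenerate_def
proof (intro ballI impI)
  fix a assume a: "a \<in> carrier (PK_algebra f)" "a \<noteq> \<zero>\<^bsub>PK_algebra f\<^esub>"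
  then obtain s where s: "a = Ann f +>\<^bsub>Sh\<^esub> s"
    by (auto simp: carrier_PK_algebra)
  interpret ideal "Ann f" Sh by (rule ideal_Ann)
  have "s \<notin> Ann f"
    using a(2) a_rcos_const[of s] by (auto simp: s PK_algebra_def quotient_algebra_simps)
  then obtain x where x: "act s f x \<noteq> 0"
    by (auto simp: Ann_def)
  \<comment> \<open>The shift by \<open>x\<close> turns the value at \<open>x\<close> into the value at \<open>0\<close>.\<close>
  let ?b = "Ann f +>\<^bsub>Sh\<^esub> Poly_Mapping.single x 1"
  have "pairing (PK_algebra f) (ell_quot f) a ?b = ell f (Poly_Mapping.single x 1 * s)"
    by (simp add: pairing_def s PK_algebra_coset_simps mult.commute)
  also have "\<dots> = act s f x"
    by (simp add: ell_def act_mult)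
  finally show "\<exists>b\<in>carrier (PK_algebra f). pairing (PK_algebra f) (ell_quot f) a b \<noteq> 0"
    using x by (intro bexI[of _ ?b]) (simp_all add: carrier_PK_algebra)
qed

theorem theorem2p3:
  fixes f :: "'l::ab_group_add \<Rightarrow> 'k::field"
  assumes lattice: "free_abelian (additive_group :: 'l monoid)"
  shows "ideal (Ann f) Sh
    \<and> algebra (ring_of_type_algebra :: 'k ring) (PK_algebra f)
    \<and> (\<lambda>t. Ann f +>\<^bsub>Sh\<^esub> t) \<in> ring_hom Sh (PK_algebra f)
    \<and> (\<forall>c. \<forall>t\<in>carrier Sh. c \<odot>\<^bsub>PK_algebra f\<^esub> (Ann f +>\<^bsub>Sh\<^esub> t) = Ann f +>\<^bsub>Sh\<^esub> (c \<odot>\<^bsub>Sh\<^esub> t))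
    \<and> linear_function Sh (ell f)
    \<and> (\<forall>t\<in>carrier Sh. ell_quot f (Ann f +>\<^bsub>Sh\<^esub> t) = ell f t)
    \<and> linear_function (PK_algebra f) (ell_quot f)
    \<and> frobenius_duality (PK_algebra f) (ell_quot f)"
proof -
  have alg: "algebra (ring_of_type_algebra :: 'k ring) (PK_algebra f)"
    unfolding PK_algebra_def by (rule algebra_quotient_algebra[OF algebra_Sh ideal_Ann])
  have hom: "(\<lambda>t. Ann f +>\<^bsub>Sh\<^esub> t) \<in> ring_hom Sh (PK_algebra f)"
    unfolding PK_algebra_def by (rule ring_hom_quotient_algebra[OF ideal_Ann])
  have "frobenius_duality (PK_algebra f) (ell_quot f)"
    unfolding frobenius_duality_def
    using linear_function_ell_quot symmetric_bilinear_pairing[OF alg] nondegenerate_ell_quot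
    by auto
  then show ?thesis
    using alg hom
    by (simp add: ideal_Ann PK_algebra_coset_simps linear_function_ell linear_function_ell_quot)
qed

end
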